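(* Let $r \geq 3$ be an integer and $l$ be any integer with $2l+1 \geq r$. If $q \geq 2lr^3$ is a power of an odd prime and $n = rq^2$, then \[ \mathrm{ex}_r\bigl(n, \{C_2, K_{2,t+1}\}\bigr) \geq \frac{l}{r^{3/2}}\, n^{3/2} - \frac{l}{r}\, n, \] where $t = (r-1)(2l^2 - l)$.
   Context: Let $G$ be a multigraph and $\mathcal{F}$ a hypergraph. $\mathcal{F}$ is a Berge-$G$ if there is a bijection $f: E(G) \to E(\mathcal{F})$ with $e \subseteq f(e)$ for every $e \in E(G)$. For a family $\mathcal{G}$ of multigraphs, a hypergraph $\mathcal{H}$ is $\mathcal{G}$-free if for every $G \in \mathcal{G}$, $\mathcal{H}$ contains no subhypergraph isomorphic to a Berge-$G$. $\mathrm{ex}_r(n,\mathcal{G})$ denotes the maximum number of edges in an $n$-vertex $r$-uniform $\mathcal{G}$-free hypergraph. $C_2$ is the multigraph consisting of two vertices joined by two parallel edges (so $C_2$-free means linear), and $K_{2,t+1}$ is the complete bipartite graph with parts of sizes $2$ and $t+1$. *)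

theory Defs
  imports Complex_Main "HOL-Computational_Algebra.Primes"
begin

text \<open>A multigraph: vertex set, edge index set, and endpoint map (each edge
  has a 2-element set of endpoints; parallel edges are distinct indices).\<close>
record mgraph =
  mverts :: "nat set"
  medges :: "nat set"
  mends  :: "nat \<Rightarrow> nat set"

definition contains_Berge :: "'a set set \<Rightarrow> mgraph \<Rightarrow> bool" where
  "contains_Berge H G \<longleftrightarrow>
     (\<exists>(\<phi>::nat \<Rightarrow> 'a) (f::nat \<Rightarrow> 'a set).
        inj_on \<phi> (mverts G) \<and> inj_on f (medges G) \<and> f ` medges G \<subseteq> H \<and>
        (\<forall>e\<in>medges G. \<phi> ` mends G e \<subseteq> f e))"

definition family_free :: "'a set set \<Rightarrow> mgraph set \<Rightarrow> bool" where
  "family_free H \<G> \<longleftrightarrow> (\<forall>G\<in>\<G>. \<not> contains_Berge H G)"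

definition uniform_hypergraph :: "nat \<Rightarrow> nat \<Rightarrow> nat set set \<Rightarrow> bool" where
  "uniform_hypergraph r n H \<longleftrightarrow> (\<forall>e\<in>H. e \<subseteq> {0..<n} \<and> card e = r)"

definition ex_r :: "nat \<Rightarrow> nat \<Rightarrow> mgraph set \<Rightarrow> nat" where
  "ex_r r n \<G> = Max {card H | H. uniform_hypergraph r n H \<and> family_free H \<G>}"

definition C2 :: mgraph where
  "C2 = \<lparr> mverts = {0,1}, medges = {0,1}, mends = (\<lambda>_. {0,1}) \<rparr>"

text \<open>K_{2,s}: parts {0,1} and {2..<s+2}; edge e (e < 2s) joins e mod 2 and e div 2 + 2.\<close>
definition K2 :: "nat \<Rightarrow> mgraph" where
  "K2 s = \<lparr> mverts = {0..<s+2}, medges = {0..<2*s},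
            mends = (\<lambda>e. {e mod 2, e div 2 + 2}) \<rparr>"

end

theory Submission
  imports "HOL-Algebra.Algebraic_Closure" "HOL-Number_Theory.Residues" Defs
begin

text \<open>
  Let \<open>F\<close> be the field with \<open>q\<close> elements and take \<open>r\<close> disjoint copies of the affine plane
  \<open>F \<times> F\<close> as vertex set. Fix distinct \<open>b\<^sub>1, \<dots>, b\<^sub>r \<in> F\<close> and a set \<open>A\<close> of \<open>l\<close> nonzero multipliers.
  The edge with parameters \<open>x, y \<in> F\<close>, \<open>s \<in> F - {0}\<close> and \<open>a \<in> A\<close> contains from the \<open>i\<close>-th copy the
  point \<open>(x + b\<^sub>i s, y + b\<^sub>i a s\<^sup>2)\<close>. The difference of two of its points is
  \<open>((b\<^sub>j - b\<^sub>i) s, (b\<^sub>j - b\<^sub>i) a s\<^sup>2)\<close>, which determines \<open>s\<close>, then \<open>a\<close>, then \<open>x\<close> and \<open>y\<close>, so the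
  hypergraph is linear.

  The neighbours in copy \<open>j\<close> of a point of copy \<open>i\<close> lie on the \<open>l\<close> parabolas with apex at that
  point and coefficients \<open>a / (b\<^sub>j - b\<^sub>i)\<close>. Two parabolas with different coefficients meet in at most
  two points, and, \<open>q\<close> being odd, two distinct translates of one parabola in at most one. Two vertices of the same
  copy hence have at most \<open>(r - 1) (2 l (l - 1) + l) = t\<close> common neighbours. If \<open>A\<close> is chosen such that
  parabolas belonging to different copies never share a coefficient, two vertices of different
  copies have at most \<open>(r - 2) 2 l\<^sup>2\<close> common neighbours, and this is at most \<open>t\<close> because
  \<open>r \<le> 2 l + 1\<close>. Since \<open>q\<close> is large, such an \<open>A\<close> can be picked greedily.
\<close>

section \<open>Finite fields\<close>

lemma (in cring) binomial:
  assumes x: "x \<in> carrier R" and y: "y \<in> carrier R"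
  shows "(x \<oplus> y) [^] (n::nat) = (\<Oplus>k\<in>{..n}. [(n choose k)] \<cdot> (x [^] k \<otimes> y [^] (n - k)))"
proof (induction n)
  case 0
  show ?case by (simp add: x y)
next
  case (Suc n)
  define f where "f k = x [^] k \<otimes> y [^] (Suc n - k)" for k
  have f: "f k \<in> carrier R" for k
    by (simp add: f_def x y)
  have "(\<Oplus>k\<in>{..n}. [(n choose k)] \<cdot> (x [^] k \<otimes> y [^] (n - k))) \<otimes> x
      = (\<Oplus>k\<in>{..n}. [(n choose k)] \<cdot> f (Suc k))"
    by (subst finsum_ldistr)
      (auto simp: x y f_def add_pow_ldistr add_pow_rdistr m_assoc m_lcomm m_comm[of _ x] intro!: finsum_cong')
  moreover have "(\<Oplus>k\<in>{..n}. [(n choose k)] \<cdot> (x [^] k \<otimes> y [^] (n - k))) \<otimes> y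
      = (\<Oplus>k\<in>{..n}. [(n choose k)] \<cdot> f k)"
    by (auto simp: finsum_ldistr x y f_def add_pow_ldistr m_assoc Suc_diff_le intro!: finsum_cong')
  \<comment> \<open>The added term has coefficient \<open>n choose Suc n\<close>, which is 0. With
    it in place, splitting off the term at 0 leaves two sums over \<open>{..n}\<close> that Pascal's
    rule merges.\<close>
  moreover have "(\<Oplus>k\<in>{..n}. [(n choose k)] \<cdot> f k) = (\<Oplus>k\<in>{..Suc n}. [(n choose k)] \<cdot> f k)"
    using f by (simp add: binomial_eq_0)
  moreover have "\<dots> = (\<Oplus>k\<in>{..n}. [(n choose Suc k)] \<cdot> f (Suc k)) \<oplus> f 0"
    using f by (subst finsum_Suc2) auto
  ultimately have "(x \<oplus> y) [^] Suc n
      = (\<Oplus>k\<in>{..n}. [(n choose k)] \<cdot> f (Suc k)) \<oplus> ((\<Oplus>k\<in>{..n}. [(n choose Suc k)] \<cdot> f (Suc k)) \<oplus> f 0)"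
    using x y by (simp add: Suc.IH r_distr)
  also have "\<dots> = (\<Oplus>k\<in>{..n}. [(n choose k)] \<cdot> f (Suc k) \<oplus> [(n choose Suc k)] \<cdot> f (Suc k)) \<oplus> f 0"
    using f by (subst finsum_addf) (auto simp: a_assoc)
  also have "\<dots> = (\<Oplus>k\<in>{..n}. [(Suc n choose Suc k)] \<cdot> f (Suc k)) \<oplus> f 0"
    using f by (simp add: add.nat_pow_mult)
  also have "\<dots> = (\<Oplus>k\<in>{..Suc n}. [(Suc n choose k)] \<cdot> f k)"
    using f by (subst finsum_Suc2) auto
  finally show ?case unfolding f_def .
qed

text \<open>For \<open>0 < k < p\<close> the prime \<open>p\<close> divides
  \<open>p choose k\<close>, so in characteristic \<open>p\<close> only the two outer terms of the
  binomial expansion survive.\<close>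

lemma (in cring) frobenius_add:
  assumes p: "prime (p::nat)" and char: "[p] \<cdot> \<one> = \<zero>"
    and x: "x \<in> carrier R" and y: "y \<in> carrier R"
  shows "(x \<oplus> y) [^] p = x [^] p \<oplus> y [^] p"
proof -
  define f where "f k = [(p choose k)] \<cdot> (x [^] k \<otimes> y [^] (p - k))" for k
  have f: "f k \<in> carrier R" for k
    by (simp add: f_def x y)
  have "f k = \<zero>" if "k \<in> {..p} - {0, p}" for k
  proof -
    from that have "p dvd (p choose k)"
      using p by (intro dvd_choose_prime) auto
    then obtain m where m: "p choose k = p * m" ..
    define z where "z = x [^] k \<otimes> y [^] (p - k)"
    have z: "z \<in> carrier R" by (simp add: z_def x y)
    have "[p] \<cdot> z = ([p] \<cdot> \<one>) \<otimes> z"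
      using z by (simp add: add_pow_ldistr)
    also have "\<dots> = \<zero>" using z by (simp add: char)
    finally have "[(p * m)] \<cdot> z = \<zero>"
      using z by (simp add: add.nat_pow_pow[symmetric])
    then show ?thesis by (simp add: f_def m z_def)
  qed
  then have "(\<Oplus>k\<in>{0, p}. f k) = (\<Oplus>k\<in>{..p}. f k)"
    using f by (intro add.finprod_mono_neutral_cong_left) auto
  moreover have "(\<Oplus>k\<in>{0, p}. f k) = y [^] p \<oplus> x [^] p"
    using f p x y by (simp add: finsum_insert prime_gt_0_nat f_def)
  ultimately show ?thesis
    using binomial[OF x y, of p] x y by (simp add: f_def a_comm)
qed

lemma (in cring) frobenius_add_power:
  assumes p: "prime (p::nat)" and char: "[p] \<cdot> \<one> = \<zero>"
    and x: "x \<in> carrier R" and y: "y \<in> carrier R"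
  shows "(x \<oplus> y) [^] (p ^ k) = x [^] (p ^ k) \<oplus> y [^] (p ^ k)"
proof (induction k)
  case 0
  show ?case using x y by (simp add: One_nat_def)
next
  case (Suc k)
  have "(x \<oplus> y) [^] (p ^ Suc k) = ((x \<oplus> y) [^] (p ^ k)) [^] p"
    using x y by (simp add: nat_pow_pow mult.commute)
  then show ?case
    using x y by (simp add: Suc.IH frobenius_add[OF p char] nat_pow_pow mult.commute)
qed

text \<open>Follows from additivity applied to \<open>x\<close> and \<open>\<ominus> x\<close>,
  which treats even and odd \<open>p\<close> alike.\<close>

lemma (in cring) frobenius_minus_power:
  assumes p: "prime (p::nat)" and char: "[p] \<cdot> \<one> = \<zero>" and x: "x \<in> carrier R"
  shows "(\<ominus> x) [^] (p ^ k) = \<ominus> (x [^] (p ^ k))"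
proof -
  have "x [^] (p ^ k) \<oplus> (\<ominus> x) [^] (p ^ k) = \<zero> [^] (p ^ k)"
    using frobenius_add_power[OF p char x a_inv_closed[OF x], of k] x by (simp add: r_neg)
  also have "\<dots> = \<zero>"
    using p by (intro nat_pow_zero) simp
  finally have "x [^] (p ^ k) \<oplus> (\<ominus> x) [^] (p ^ k) = \<zero>" .
  then show ?thesis
    using x by (metis a_inv_closed minus_equality nat_pow_closed a_comm)
qed

section \<open>Fixed points of the Frobenius map and existence of finite fields\<close>

lemma (in ring_hom_ring) hom_add_pow:
  assumes "x \<in> carrier R"
  shows "h ([(n::nat)] \<cdot>\<^bsub>R\<^esub> x) = [n] \<cdot>\<^bsub>S\<^esub> h x"
  using assms by (induction n) (simp_all add: R.add.nat_pow_Suc S.add.nat_pow_Suc)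

text \<open>The fixed points are the roots of \<open>X^q - X\<close> with \<open>q = p ^ k\<close>.
  Over an algebraically closed field this polynomial has \<open>q\<close> roots counted with
  multiplicity, so it remains to see that every root is simple.\<close>

lemma (in algebraically_closed) card_frobenius_fixed:
  fixes p k :: nat
  assumes p: "prime p" and k: "k > 0" and char: "[p] \<cdot> \<one> = \<zero>"
  shows "card {x \<in> carrier L. x [^] (p ^ k) = x} = p ^ k"
proof -
  define q where "q = p ^ k"
  have q: "q \<ge> 2"
    using prime_ge_2_nat[OF p] k self_le_power[of p k] unfolding q_def by linarith
  interpret UP: domain "poly_ring L"
    by (rule univ_poly_is_domain[OF carrier_is_subring])
  interpret C: ring_hom_ring L "poly_ring L" poly_of_const
    using canonical_embedding_ring_hom[OF carrier_is_subring] by simp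
  have X: "X \<in> carrier (poly_ring L)"
    by (rule var_closed[OF carrier_is_subring])
  \<comment> \<open>The characteristic is carried over to the polynomial ring because the Frobenius
    identity is applied to polynomials below.\<close>
  have char': "[p] \<cdot>\<^bsub>poly_ring L\<^esub> \<one>\<^bsub>poly_ring L\<^esub> = \<zero>\<^bsub>poly_ring L\<^esub>"
    using C.hom_add_pow[of \<one> p] char by simp
  define P where "P = X [^]\<^bsub>poly_ring L\<^esub> q \<ominus>\<^bsub>poly_ring L\<^esub> X"
  have P: "P \<in> carrier (poly_ring L)"
    using X by (simp add: P_def)
  have Xq: "X [^]\<^bsub>poly_ring L\<^esub> q = monom \<one> q"
    using unitary_monom_eq_var_pow[OF carrier_is_subring] by simp
  have "degree (\<ominus>\<^bsub>poly_ring L\<^esub> X) = 1"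
    using univ_poly_a_inv_degree[OF carrier_is_subring X] by (simp add: var_def)
  moreover have "degree (monom \<one> q) = q"
    by (simp add: monom_def)
  moreover have "polynomial (carrier L) (monom \<one> q)" "polynomial (carrier L) (\<ominus>\<^bsub>poly_ring L\<^esub> X)"
    using X by (simp_all add: univ_poly_carrier flip: Xq)
  \<comment> \<open>Since \<open>q \<ge> 2\<close>, the two summands have different degrees and the
    leading term of \<open>X^q\<close> is not cancelled.\<close>
  ultimately have deg: "degree P = q"
    using q poly_add_degree_eq[OF carrier_is_subring, of "monom \<one> q" "\<ominus>\<^bsub>poly_ring L\<^esub> X"]
    by (simp add: P_def a_minus_def Xq univ_poly_add)
  then have P0: "P \<noteq> []" using q by auto
  have root: "is_root P x \<longleftrightarrow> x \<in> carrier L \<and> x [^] q = x" for x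
  proof (cases "x \<in> carrier L")
    case True
    interpret E: ring_hom_ring "poly_ring L" L "\<lambda>f. eval f x"
      by (rule eval_ring_hom[OF carrier_is_subring True])
    have "eval P x = x [^] q \<ominus> x"
      using X True by (simp add: P_def a_minus_def E.hom_nat_pow eval_var)
    then show ?thesis using True P0 by (simp add: is_root_def)
  qed (simp add: is_root_def)
  \<comment> \<open>For a root \<open>a\<close> and \<open>b = X - a\<close> the Frobenius map gives \<open>b\<^sup>q = P + b\<close>, so \<open>b\<^sup>2\<close> cannot divide \<open>P\<close>.\<close>
  have "alg_mult P a \<le> 1" for a
  proof (rule ccontr)
    assume "\<not> alg_mult P a \<le> 1"
    then have mult: "2 \<le> alg_mult P a" by simp
    then have "is_root P a"
      using alg_mult_gt_zero_iff_is_root[OF P, of a] by simp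
    then have a: "a \<in> carrier L" "a [^] q = a"
      by (simp_all add: root)
    define b where "b = [\<one>, \<ominus> a]"
    have b_eq: "b = X \<oplus>\<^bsub>poly_ring L\<^esub> poly_of_const (\<ominus> a)"
      using a by (auto simp: b_def univ_poly_add var_def poly_of_const_def)
    have b: "b \<in> carrier (poly_ring L)"
      using X a by (simp add: b_eq)
    have "b [^]\<^bsub>poly_ring L\<^esub> q = X [^]\<^bsub>poly_ring L\<^esub> q \<oplus>\<^bsub>poly_ring L\<^esub> poly_of_const (\<ominus> a) [^]\<^bsub>poly_ring L\<^esub> q"
      unfolding b_eq q_def using X a by (intro UP.frobenius_add_power p char') auto
    also have "poly_of_const (\<ominus> a) [^]\<^bsub>poly_ring L\<^esub> q = poly_of_const (\<ominus> a)"
      using frobenius_minus_power[OF p char, of a k] a C.hom_nat_pow[of "\<ominus> a" q] by (simp add: q_def)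
    also have "X [^]\<^bsub>poly_ring L\<^esub> q \<oplus>\<^bsub>poly_ring L\<^esub> poly_of_const (\<ominus> a) = P \<oplus>\<^bsub>poly_ring L\<^esub> b"
      unfolding P_def b_eq using X a by (simp add: UP.minus_eq UP.a_ac UP.l_neg UP.r_neg2 UP.r_neg1)
    finally have bq: "b [^]\<^bsub>poly_ring L\<^esub> q = P \<oplus>\<^bsub>poly_ring L\<^esub> b" .
    from le_alg_mult_imp_pdivides[OF a(1) P mult] obtain u
      where u: "u \<in> carrier (poly_ring L)" "P = b [^]\<^bsub>poly_ring L\<^esub> (2::nat) \<otimes>\<^bsub>poly_ring L\<^esub> u"
      unfolding pdivides_def factor_def b_def by blast
    have "b [^]\<^bsub>poly_ring L\<^esub> q = b [^]\<^bsub>poly_ring L\<^esub> (2::nat) \<otimes>\<^bsub>poly_ring L\<^esub> b [^]\<^bsub>poly_ring L\<^esub> (q - 2)"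
      using q UP.nat_pow_mult[OF b, of 2 "q - 2"] by (simp only: le_add_diff_inverse)
    \<comment> \<open>Both \<open>b^q\<close> and \<open>P\<close> are multiples of
      \<open>b^2\<close>, hence so is their difference \<open>b\<close>, although its degree is only
      1.\<close>
    with bq have "b = b [^]\<^bsub>poly_ring L\<^esub> (2::nat) \<otimes>\<^bsub>poly_ring L\<^esub> (b [^]\<^bsub>poly_ring L\<^esub> (q - 2) \<ominus>\<^bsub>poly_ring L\<^esub> u)"
      using b u by (simp add: UP.r_distr UP.minus_eq UP.r_minus UP.a_ac UP.r_neg1 UP.r_neg2 UP.r_neg UP.l_neg)
    then have "b [^]\<^bsub>poly_ring L\<^esub> (2::nat) pdivides b"
      unfolding pdivides_def factor_def using b u by blast
    then have "degree (b [^]\<^bsub>poly_ring L\<^esub> (2::nat)) \<le> degree b"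
      using b by (intro pdivides_imp_degree_le[OF carrier_is_subring]) (auto simp: b_def)
    moreover have "degree (b [^]\<^bsub>poly_ring L\<^esub> (2::nat)) = 2"
      using polynomial_pow_degree[OF b, of 2] by (simp add: b_def)
    ultimately show False by (simp add: b_def)
  qed
  then have "count (roots P) x = 1" if "x \<in># roots P" for x
    using that by (metis alg_mult_eq_count_roots[OF P] count_greater_zero_iff le_antisym less_eq_Suc_le One_nat_def)
  then have "roots P = mset_set (set_mset (roots P))"
    by (intro multiset_eqI) (metis count_mset_set(1,3) finite_set_mset not_in_iff)
  then have "size (roots P) = card (set_mset (roots P))"
    by (metis size_mset_set)
  moreover have "set_mset (roots P) = {x \<in> carrier L. x [^] q = x}"
    using roots_mem_iff_is_root[OF P] root by auto
  moreover have "size (roots P) = q"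
    using roots_over_carrier[OF P] deg by (simp add: splitted_def)
  ultimately show ?thesis by (simp add: q_def)
qed

text \<open>The field consists of the solutions of \<open>x^(p^k) = x\<close> in an algebraic
  closure of the integers modulo \<open>p\<close>. The element type is the one that
  \<open>exists_closure\<close> produces from a ring over \<open>int\<close>.\<close>

lemma exists_finite_field:
  assumes p: "prime (p::nat)" and k: "k > 0"
  shows "\<exists>F :: ((int list \<times> nat) multiset \<Rightarrow> int) ring. field F \<and> card (carrier F) = p ^ k"
proof -
  define R where "R = residue_ring (int p)"
  interpret residues_prime p R
    by unfold_locales (use p in \<open>auto simp: R_def\<close>)
  obtain L :: "((int list \<times> nat) multiset \<Rightarrow> int) ring"
    where L: "algebraic_closure L (indexed_const ` carrier R)" and hom: "indexed_const \<in> ring_hom R L"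
    by (rule exists_closure)
  interpret L: algebraic_closure L "indexed_const ` carrier R" by (rule L)
  interpret h: ring_hom_ring R L indexed_const
    by (intro ring_hom_ringI2 ring_axioms L.ring_axioms hom)
  have pow: "[n] \<cdot>\<^bsub>R\<^esub> \<one>\<^bsub>R\<^esub> = int n mod int p" for n :: nat
    by (induction n) (auto simp: res_zero_eq res_add_eq res_one_eq mod_simps add.nat_pow_Suc add.commute)
  have "[p] \<cdot>\<^bsub>R\<^esub> \<one>\<^bsub>R\<^esub> = \<zero>\<^bsub>R\<^esub>"
    by (simp add: pow res_zero_eq)
  then have char: "[p] \<cdot>\<^bsub>L\<^esub> \<one>\<^bsub>L\<^esub> = \<zero>\<^bsub>L\<^esub>"
    using h.hom_add_pow[of "\<one>\<^bsub>R\<^esub>" p] by simp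
  define S where "S = {x \<in> carrier L. x [^]\<^bsub>L\<^esub> (p ^ k) = x}"
  have "subfield S L"
  proof (rule L.subfieldI')
    show "subring S L"
    proof (rule L.subringI)
      show "S \<subseteq> carrier L" "\<one>\<^bsub>L\<^esub> \<in> S" by (auto simp: S_def)
    qed (auto simp: S_def L.frobenius_minus_power[OF p char] L.frobenius_add_power[OF p char] L.nat_pow_distrib)
  next
    fix x assume "x \<in> S - {\<zero>\<^bsub>L\<^esub>}"
    then have x: "x \<in> Units L" "x \<in> carrier L" "x [^]\<^bsub>L\<^esub> (p ^ k) = x"
      by (auto simp: S_def L.field_Units)
    \<comment> \<open>Raising \<open>x\<close> times its inverse to the power \<open>p ^ k\<close>
      shows that the power of the inverse is again an inverse of \<open>x\<close>, so the inverse is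
      a fixed point as well.\<close>
    have "x [^]\<^bsub>L\<^esub> (p ^ k) \<otimes>\<^bsub>L\<^esub> inv\<^bsub>L\<^esub> x [^]\<^bsub>L\<^esub> (p ^ k) = \<one>\<^bsub>L\<^esub>"
      using x(1,2) by (simp flip: L.nat_pow_distrib)
    then have "inv\<^bsub>L\<^esub> x = inv\<^bsub>L\<^esub> x [^]\<^bsub>L\<^esub> (p ^ k)"
      using x by (intro L.comm_inv_char) auto
    then show "inv\<^bsub>L\<^esub> x \<in> S"
      using x by (simp add: S_def)
  qed
  then have "field (L\<lparr>carrier := S\<rparr>)"
    by (rule L.subfield_iff(2))
  moreover have "card (carrier (L\<lparr>carrier := S\<rparr>)) = p ^ k"
    using L.card_frobenius_fixed[OF p k char] by (simp add: S_def)
  ultimately show ?thesis by blast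
qed

text \<open>The order of the additive group annihilates \<open>\<one>\<close>. If 2 did so too, an
  odd order would force \<open>\<one> = \<zero>\<close>.\<close>

lemma (in domain) two_neq_zero_if_odd_order:
  assumes "odd (card (carrier R))"
  shows "\<one> \<oplus> \<one> \<noteq> \<zero>"
proof
  assume two: "\<one> \<oplus> \<one> = \<zero>"
  obtain m where m: "card (carrier R) = 2 * m + 1"
    using assms by (rule oddE)
  have "[(2 * m + 1)] \<cdot> \<one> = \<zero>"
    using add.pow_order_eq_1[of \<one>] by (simp add: order_def m)
  moreover have "[(2 * m)] \<cdot> \<one> = [m] \<cdot> ([(2::nat)] \<cdot> \<one>)"
    by (rule add.nat_pow_pow[symmetric]) simp
  moreover have "[(2::nat)] \<cdot> \<one> = \<zero>"
    using two by (simp add: numeral_2_eq_2)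
  ultimately show False
    by simp
qed

section \<open>Intersections of parabolas\<close>

text \<open>The equation describes where the parabola with coefficient \<open>\<alpha>\<close> and
  apex at the origin meets the one with coefficient \<open>\<beta>\<close> and apex
  \<open>(d, e)\<close>. Subtracting the instances for \<open>u\<close> and \<open>v\<close> removes
  \<open>e\<close>, and the common factor \<open>u \<ominus> v\<close> cancels.\<close>

lemma (in domain) quadratic_solutions_eq:
  assumes c: "\<alpha> \<in> carrier R" "\<beta> \<in> carrier R" "d \<in> carrier R" "e \<in> carrier R" "u \<in> carrier R" "v \<in> carrier R"
    and u: "\<alpha> \<otimes> (u \<otimes> u) = e \<oplus> \<beta> \<otimes> ((u \<ominus> d) \<otimes> (u \<ominus> d))"
    and v: "\<alpha> \<otimes> (v \<otimes> v) = e \<oplus> \<beta> \<otimes> ((v \<ominus> d) \<otimes> (v \<ominus> d))"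
    and "u \<noteq> v"
  shows "\<alpha> \<otimes> (u \<oplus> v) = \<beta> \<otimes> ((u \<ominus> d) \<oplus> (v \<ominus> d))"
proof -
  have square_diff: "(x \<ominus> y) \<otimes> (a \<otimes> (x \<oplus> y)) = a \<otimes> (x \<otimes> x) \<ominus> a \<otimes> (y \<otimes> y)"
    if "x \<in> carrier R" "y \<in> carrier R" "a \<in> carrier R" for x y a
    using that by algebra
  have add_diff: "(e \<oplus> x) \<ominus> (e \<oplus> y) = x \<ominus> y" if "x \<in> carrier R" "y \<in> carrier R" for x y
    using that c by algebra
  have "(u \<ominus> d) \<ominus> (v \<ominus> d) = u \<ominus> v"
    using c by algebra
  moreover have "(u \<ominus> v) \<otimes> (\<alpha> \<otimes> (u \<oplus> v)) = ((u \<ominus> d) \<ominus> (v \<ominus> d)) \<otimes> (\<beta> \<otimes> ((u \<ominus> d) \<oplus> (v \<ominus> d)))"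
    using c by (simp only: square_diff minus_closed u v add_diff m_closed)
  ultimately have "(u \<ominus> v) \<otimes> (\<alpha> \<otimes> (u \<oplus> v)) = (u \<ominus> v) \<otimes> (\<beta> \<otimes> ((u \<ominus> d) \<oplus> (v \<ominus> d)))"
    by simp
  then show ?thesis
    using c \<open>u \<noteq> v\<close> by (subst (asm) m_lcancel) auto
qed

lemma card_le_1_if_all_eq:
  assumes "\<And>u v. u \<in> S \<Longrightarrow> v \<in> S \<Longrightarrow> u = v"
  shows "card S \<le> 1"
  using assms by (cases "finite S") (auto simp: card_le_Suc0_iff_eq)

text \<open>Once one element is removed, at most one other remains. An infinite \<open>S\<close> has
  \<open>card S = 0\<close>.\<close>

lemma card_le_2_if_rest_eq:
  assumes "\<And>u v w. u \<in> S \<Longrightarrow> v \<in> S - {u} \<Longrightarrow> w \<in> S - {u} \<Longrightarrow> v = w"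
  shows "card S \<le> 2"
proof (cases "S = {}")
  case False
  then obtain u where u: "u \<in> S" by blast
  show ?thesis
  proof (cases "finite S")
    case True
    then have "card (S - {u}) \<le> Suc 0"
      using assms[OF u] by (subst card_le_Suc0_iff_eq) auto
    then show ?thesis
      using u True by simp
  qed simp
qed simp

text \<open>With one solution \<open>u\<close> fixed, \<open>quadratic_solutions_eq\<close> is
  linear in the other solution with leading coefficient \<open>\<alpha> \<ominus> \<beta>\<close>,
  hence determines it.\<close>

lemma (in domain) card_quadratic_solutions_le_2:
  assumes c: "\<alpha> \<in> carrier R" "\<beta> \<in> carrier R" "d \<in> carrier R" "e \<in> carrier R"
    and "\<alpha> \<noteq> \<beta>"
  shows "card {u \<in> carrier R. \<alpha> \<otimes> (u \<otimes> u) = e \<oplus> \<beta> \<otimes> ((u \<ominus> d) \<otimes> (u \<ominus> d))} \<le> 2" (is "card ?S \<le> 2")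
proof (rule card_le_2_if_rest_eq)
  fix u v w assume uvw: "u \<in> ?S" "v \<in> ?S - {u}" "w \<in> ?S - {u}"
  have uv: "\<alpha> \<otimes> (u \<oplus> v) = \<beta> \<otimes> ((u \<ominus> d) \<oplus> (v \<ominus> d))"
    and uw: "\<alpha> \<otimes> (u \<oplus> w) = \<beta> \<otimes> ((u \<ominus> d) \<oplus> (w \<ominus> d))"
    using quadratic_solutions_eq[OF c, of u v] quadratic_solutions_eq[OF c, of u w] uvw by auto
  have factor_diff: "a \<otimes> (x \<oplus> y) \<ominus> a \<otimes> (x \<oplus> z) = a \<otimes> (y \<ominus> z)"
    if "a \<in> carrier R" "x \<in> carrier R" "y \<in> carrier R" "z \<in> carrier R" for a x y z
    using that by algebra
  have "\<alpha> \<otimes> (v \<ominus> w) = \<alpha> \<otimes> (u \<oplus> v) \<ominus> \<alpha> \<otimes> (u \<oplus> w)"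
    using c uvw by (simp add: factor_diff)
  also have "\<dots> = \<beta> \<otimes> ((v \<ominus> d) \<ominus> (w \<ominus> d))"
    unfolding uv uw using c uvw by (simp add: factor_diff)
  also have "(v \<ominus> d) \<ominus> (w \<ominus> d) = v \<ominus> w"
    using c uvw by (auto simp: minus_eq minus_add a_ac r_neg1 r_neg2)
  finally have "\<alpha> \<otimes> (v \<ominus> w) = \<beta> \<otimes> (v \<ominus> w)" .
  then show "v = w"
    using uvw c \<open>\<alpha> \<noteq> \<beta>\<close> m_rcancel[of "v \<ominus> w" \<alpha> \<beta>] by auto
qed

text \<open>Equal coefficients make the quadratic terms cancel. For \<open>d = \<zero>\<close> the
  equation reduces to \<open>e = \<zero>\<close>, which is excluded; otherwise two solutions would
  give \<open>2 d = 0\<close>, which is impossible in odd characteristic.\<close>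

lemma (in domain) card_quadratic_solutions_le_1:
  assumes c: "\<alpha> \<in> carrier R" "d \<in> carrier R" "e \<in> carrier R"
    and "\<alpha> \<noteq> \<zero>" "\<one> \<oplus> \<one> \<noteq> \<zero>" "d \<noteq> \<zero> \<or> e \<noteq> \<zero>"
  shows "card {u \<in> carrier R. \<alpha> \<otimes> (u \<otimes> u) = e \<oplus> \<alpha> \<otimes> ((u \<ominus> d) \<otimes> (u \<ominus> d))} \<le> 1" (is "card ?S \<le> 1")
proof (cases "d = \<zero>")
  case True
  have "?S = {}"
  proof (intro equals0I)
    fix u assume "u \<in> ?S"
    then have u: "u \<in> carrier R" and eq: "\<alpha> \<otimes> (u \<otimes> u) = e \<oplus> \<alpha> \<otimes> ((u \<ominus> d) \<otimes> (u \<ominus> d))"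
      by blast+
    have "u \<ominus> d = u"
      using u True by (simp add: minus_eq)
    with eq have "e \<oplus> \<alpha> \<otimes> (u \<otimes> u) = \<alpha> \<otimes> (u \<otimes> u)"
      by (simp only:)
    then have "e = \<zero>"
      using c u by simp
    with True assms show False by simp
  qed
  then show ?thesis by (simp only: card.empty)
next
  case False
  show ?thesis
  proof (rule card_le_1_if_all_eq, rule ccontr)
    fix u v assume uv: "u \<in> ?S" "v \<in> ?S"
    assume "u \<noteq> v"
    with uv have "\<alpha> \<otimes> (u \<oplus> v) = \<alpha> \<otimes> ((u \<ominus> d) \<oplus> (v \<ominus> d))"
      by (intro quadratic_solutions_eq[OF c(1,1,2,3)]) auto
    then have "u \<oplus> v = (u \<ominus> d) \<oplus> (v \<ominus> d)"
      using uv c \<open>\<alpha> \<noteq> \<zero>\<close> by (subst (asm) m_lcancel) auto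
    also have "\<dots> = (u \<oplus> v) \<ominus> (\<one> \<oplus> \<one>) \<otimes> d"
      using uv c by (simp add: minus_eq l_distr minus_add a_ac)
    finally have "(\<one> \<oplus> \<one>) \<otimes> d = \<zero>"
      using uv c by (simp add: minus_eq)
    then show False
      using c False assms(5) by (simp add: integral_iff)
  qed
qed

section \<open>Berge hypergraphs\<close>

lemma contains_BergeE:
  assumes "contains_Berge H G"
  obtains \<phi> f where "inj_on \<phi> (mverts G)" "inj_on f (medges G)" "f ` medges G \<subseteq> H"
    "\<And>e. e \<in> medges G \<Longrightarrow> \<phi> ` mends G e \<subseteq> f e"
  using assms unfolding contains_Berge_def by (elim exE conjE) simp

text \<open>Pulls a Berge copy back along an injective relabelling of the vertices. Every vertex of
  \<open>G\<close> must lie on an edge, since only then is its image known to be in the range of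
  \<open>h\<close>, where \<open>h\<close> can be inverted.\<close>

lemma contains_Berge_imageD:
  assumes inj: "inj_on h (\<Union>H)" and G: "mverts G = \<Union> (mends G ` medges G)"
    and "contains_Berge ((`) h ` H) G"
  shows "contains_Berge H G"
proof -
  obtain \<phi> f where \<phi>: "inj_on \<phi> (mverts G)" and f: "inj_on f (medges G)" "f ` medges G \<subseteq> (`) h ` H"
    and \<phi>f: "\<And>e. e \<in> medges G \<Longrightarrow> \<phi> ` mends G e \<subseteq> f e"
    using assms(3) by (rule contains_BergeE) (rule that)
  from f(2) have "\<forall>e\<in>medges G. \<exists>g\<in>H. f e = h ` g" by blast
  then obtain f' where f': "\<And>e. e \<in> medges G \<Longrightarrow> f' e \<in> H \<and> f e = h ` f' e" by metis
  define \<phi>' where "\<phi>' = inv_into (\<Union>H) h \<circ> \<phi>"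
  have "\<phi> ` mverts G \<subseteq> h ` \<Union>H"
  proof
    fix x assume "x \<in> \<phi> ` mverts G"
    then obtain e where e: "e \<in> medges G" "x \<in> \<phi> ` mends G e"
      unfolding G by blast
    then have "x \<in> h ` f' e" "f' e \<in> H"
      using \<phi>f[OF e(1)] f'[OF e(1)] by auto
    then show "x \<in> h ` \<Union>H" by blast
  qed
  then have "inj_on \<phi>' (mverts G)"
    unfolding \<phi>'_def by (intro comp_inj_on \<phi> inj_on_inv_into)
  moreover have "inj_on f' (medges G)"
    using f(1) f' by (metis inj_on_def)
  moreover have "\<phi>' ` mends G e \<subseteq> f' e" if e: "e \<in> medges G" for e
  proof
    fix x assume "x \<in> \<phi>' ` mends G e"
    then obtain v where v: "v \<in> mends G e" "x = inv_into (\<Union>H) h (\<phi> v)"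
      by (auto simp: \<phi>'_def)
    with \<phi>f[OF e] f'[OF e] obtain w where "w \<in> f' e" "\<phi> v = h w" by blast
    with v f'[OF e] show "x \<in> f' e"
      by (metis UnionI inj inv_into_f_f)
  qed
  ultimately show ?thesis
    unfolding contains_Berge_def using f' by blast
qed

lemma contains_Berge_C2:
  assumes "contains_Berge H C2"
  shows "\<exists>e\<in>H. \<exists>e'\<in>H. \<exists>x y. e \<noteq> e' \<and> x \<noteq> y \<and> {x, y} \<subseteq> e \<inter> e'"
proof -
  obtain \<phi> f where "inj_on \<phi> (mverts C2)" "inj_on f (medges C2)" "f ` medges C2 \<subseteq> H"
    "\<And>e. e \<in> medges C2 \<Longrightarrow> \<phi> ` mends C2 e \<subseteq> f e"
    using assms by (rule contains_BergeE) (rule that)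
  then have "f 0 \<in> H" "f 1 \<in> H" "f 0 \<noteq> f 1" "\<phi> 0 \<noteq> \<phi> 1" "{\<phi> 0, \<phi> 1} \<subseteq> f 0 \<inter> f 1"
    by (simp_all add: C2_def)
  then show ?thesis by blast
qed

text \<open>Retains only what a codegree bound can contradict: the images of the part of size
  \<open>s\<close> are common neighbours of the images of 0 and 1.\<close>

lemma contains_Berge_K2:
  assumes "contains_Berge H (K2 s)"
  obtains x y S where "x \<noteq> y" "card S = s" "x \<notin> S" "y \<notin> S"
    "\<And>z. z \<in> S \<Longrightarrow> (\<exists>e\<in>H. {x, z} \<subseteq> e) \<and> (\<exists>e\<in>H. {y, z} \<subseteq> e)"
proof -
  obtain \<phi> f where K2: "inj_on \<phi> (mverts (K2 s))" "f ` medges (K2 s) \<subseteq> H"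
    "\<And>e. e \<in> medges (K2 s) \<Longrightarrow> \<phi> ` mends (K2 s) e \<subseteq> f e"
    using assms by (rule contains_BergeE) (rule that)
  then have \<phi>: "inj_on \<phi> {0..<s+2}" and f: "f ` {0..<2*s} \<subseteq> H"
    by (simp_all add: K2_def)
  have \<phi>f: "{\<phi> (e mod 2), \<phi> (e div 2 + 2)} \<subseteq> f e" if "e < 2 * s" for e
    using K2(3)[of e] that by (simp add: K2_def)
  have eq: "\<phi> i = \<phi> j \<longleftrightarrow> i = j" if "i < s + 2" "j < s + 2" for i j
    using \<phi> that by (auto simp: inj_on_eq_iff)
  have "card (\<phi> ` {2..<s+2}) = s"
    using inj_on_subset[OF \<phi>, of "{2..<s+2}"] by (simp add: card_image)
  moreover have "\<phi> 0 \<noteq> \<phi> 1" "\<phi> 0 \<notin> \<phi> ` {2..<s+2}" "\<phi> 1 \<notin> \<phi> ` {2..<s+2}"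
    by (auto simp: eq)
  moreover have "(\<exists>e\<in>H. {\<phi> 0, \<phi> v} \<subseteq> e) \<and> (\<exists>e\<in>H. {\<phi> 1, \<phi> v} \<subseteq> e)" if "v \<in> {2..<s+2}" for v
  proof -
    define w where "w = v - 2"
    have w: "v = w + 2" "w < s" using that by (auto simp: w_def)
    \<comment> \<open>In the encoding of \<open>K2\<close>, the edges \<open>2 * w\<close> and
      \<open>2 * w + 1\<close> join \<open>w + 2\<close> to 0 and to 1.\<close>
    have "f (2 * w) \<in> H" "f (2 * w + 1) \<in> H" using f w by auto
    with \<phi>f[of "2 * w"] \<phi>f[of "2 * w + 1"] w show ?thesis by auto
  qed
  ultimately show ?thesis
    by (intro that[of "\<phi> 0" "\<phi> 1" "\<phi> ` {2..<s+2}"]) auto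
qed

text \<open>All edges lie in \<open>{0..<n}\<close>, so the \<open>Max\<close> ranges over a finite
  set of cardinalities.\<close>

lemma card_le_ex_r:
  assumes "uniform_hypergraph r n H" "family_free H \<G>"
  shows "card H \<le> ex_r r n \<G>"
proof -
  have "{card H | H. uniform_hypergraph r n H \<and> family_free H \<G>} \<subseteq> card ` Pow (Pow {0..<n})"
    unfolding uniform_hypergraph_def by blast
  then have "finite {card H | H. uniform_hypergraph r n H \<and> family_free H \<G>}"
    by (rule finite_subset) simp
  then show ?thesis
    unfolding ex_r_def using assms by (intro Max_ge) auto
qed

section \<open>Choosing the multipliers\<close>

text \<open>Each chosen element blocks at most \<open>m\<close> candidates, itself included, so
  before the last choice fewer than \<open>l * m\<close> candidates are blocked.\<close>

lemma greedy_independent_set: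
  assumes "finite U" "\<And>x y. bad x y \<Longrightarrow> bad y x"
    and bad: "\<And>x. x \<in> U \<Longrightarrow> card {y \<in> U. y = x \<or> bad x y} \<le> m"
    and "l * m \<le> card U" "m > 0"
  shows "\<exists>A\<subseteq>U. card A = l \<and> (\<forall>x\<in>A. \<forall>y\<in>A. x \<noteq> y \<longrightarrow> \<not> bad x y)"
  using \<open>l * m \<le> card U\<close>
proof (induction l)
  case 0
  show ?case by (intro exI[of _ "{}"]) simp
next
  case (Suc l)
  then obtain A where A: "A \<subseteq> U" "card A = l" "\<And>x y. x \<in> A \<Longrightarrow> y \<in> A \<Longrightarrow> x \<noteq> y \<Longrightarrow> \<not> bad x y"
    by auto
  have fin: "finite A" using A(1) assms(1) by (rule finite_subset)
  have "card (\<Union>x\<in>A. {y \<in> U. y = x \<or> bad x y}) \<le> (\<Sum>x\<in>A. card {y \<in> U. y = x \<or> bad x y})"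
    by (rule card_UN_le[OF fin])
  also have "\<dots> \<le> (\<Sum>x\<in>A. m)"
    using A(1) by (intro sum_mono bad) auto
  also have "\<dots> < card U"
    using A(2) Suc.prems \<open>m > 0\<close> by simp
  finally have "card (\<Union>x\<in>A. {y \<in> U. y = x \<or> bad x y}) < card U" .
  moreover have "finite (\<Union>x\<in>A. {y \<in> U. y = x \<or> bad x y})"
    using fin assms(1) by simp
  ultimately have "\<not> U \<subseteq> (\<Union>x\<in>A. {y \<in> U. y = x \<or> bad x y})"
    by (meson card_mono leD)
  then obtain z where z: "z \<in> U" "z \<notin> A" "\<And>x. x \<in> A \<Longrightarrow> \<not> bad x z" by blast
  have "insert z A \<subseteq> U" "card (insert z A) = Suc l"
    using A z(1,2) fin by auto
  moreover have "\<forall>x\<in>insert z A. \<forall>y\<in>insert z A. x \<noteq> y \<longrightarrow> \<not> bad x y"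
    using A(3) z(3) assms(2) by blast
  ultimately show ?case by blast
qed

text \<open>The inequality says \<open>a / (b j - b i) \<noteq> a' / (b j - b i')\<close> with
  denominators cleared. For fixed \<open>a\<close> each triple of indices rules out at most one
  \<open>a'\<close>, so \<open>a\<close> blocks at most \<open>r ^ 3 + 1\<close> candidates and the
  greedy choice applies.\<close>

lemma (in field) exists_separated_multipliers:
  assumes fin: "finite (carrier R)" and b: "\<And>i. i < r \<Longrightarrow> b i \<in> carrier R" "inj_on b {..<r}"
    and card: "l * (r ^ 3 + 1) < card (carrier R)"
  shows "\<exists>A\<subseteq>carrier R - {\<zero>}. card A = l \<and>
    (\<forall>i<r. \<forall>i'<r. \<forall>j<r. \<forall>a\<in>A. \<forall>a'\<in>A. i \<noteq> i' \<and> i \<noteq> j \<and> i' \<noteq> j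
      \<longrightarrow> a \<otimes> (b j \<ominus> b i') \<noteq> a' \<otimes> (b j \<ominus> b i))"
proof -
  define bad where "bad a a' \<longleftrightarrow> (\<exists>i<r. \<exists>i'<r. \<exists>j<r. i \<noteq> i' \<and> i \<noteq> j \<and> i' \<noteq> j \<and>
    a \<otimes> (b j \<ominus> b i') = a' \<otimes> (b j \<ominus> b i))" for a a'
  have b_diff: "b j \<ominus> b i \<in> carrier R" "b j \<ominus> b i \<noteq> \<zero>" if "i < r" "j < r" "i \<noteq> j" for i j
    using that b by (auto simp: inj_on_eq_iff)
  \<comment> \<open>Exchanging \<open>i\<close> and \<open>i'\<close> exchanges the two sides of the
    equation.\<close>
  have "bad a' a" if "bad a a'" for a a'
    using that unfolding bad_def by metis
  moreover have "card {a' \<in> carrier R - {\<zero>}. a' = a \<or> bad a a'} \<le> r ^ 3 + 1" if a: "a \<in> carrier R - {\<zero>}" for a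
  proof -
    define f where "f = (\<lambda>(i, i', j). a \<otimes> (b j \<ominus> b i') \<otimes> inv (b j \<ominus> b i))"
    have "{a' \<in> carrier R - {\<zero>}. a' = a \<or> bad a a'} \<subseteq> insert a (f ` ({..<r} \<times> {..<r} \<times> {..<r}))"
    proof
      fix a' assume a': "a' \<in> {a' \<in> carrier R - {\<zero>}. a' = a \<or> bad a a'}"
      show "a' \<in> insert a (f ` ({..<r} \<times> {..<r} \<times> {..<r}))"
      proof (cases "a' = a")
        case False
        with a' obtain i i' j where ij: "i < r" "i' < r" "j < r" "i \<noteq> j" "i' \<noteq> j"
          "a \<otimes> (b j \<ominus> b i') = a' \<otimes> (b j \<ominus> b i)"
          unfolding bad_def by blast
        have "f (i, i', j) = a' \<otimes> (b j \<ominus> b i) \<otimes> inv (b j \<ominus> b i)"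
          by (simp add: f_def ij(6))
        also have "\<dots> = a'"
          using a' b_diff[OF ij(1,3,4)] by (simp add: m_assoc field_Units)
        finally show ?thesis
          using ij by (intro insertI2 image_eqI[of _ f "(i, i', j)"]) auto
      qed simp
    qed
    then have "card {a' \<in> carrier R - {\<zero>}. a' = a \<or> bad a a'} \<le> card (insert a (f ` ({..<r} \<times> {..<r} \<times> {..<r})))"
      by (intro card_mono) auto
    also have "\<dots> \<le> Suc (card (f ` ({..<r} \<times> {..<r} \<times> {..<r})))"
      by (rule card_insert_le_m1) simp_all
    also have "\<dots> \<le> Suc (card ({..<r} \<times> {..<r} \<times> {..<r}))"
      by (simp only: Suc_le_mono) (rule card_image_le, simp)
    finally show ?thesis
      by (simp add: card_cartesian_product power3_eq_cube)
  qed
  \<comment> \<open>The strict inequality in the hypothesis pays for the removal of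
    \<open>\<zero>\<close>.\<close>
  moreover have "l * (r ^ 3 + 1) \<le> card (carrier R - {\<zero>})"
    using card by (simp add: card_Diff_singleton)
  ultimately obtain A where A: "A \<subseteq> carrier R - {\<zero>}" "card A = l"
    "\<And>a a'. a \<in> A \<Longrightarrow> a' \<in> A \<Longrightarrow> a \<noteq> a' \<Longrightarrow> \<not> bad a a'"
    using greedy_independent_set[of "carrier R - {\<zero>}" bad "r ^ 3 + 1" l] fin by auto
  have "a \<otimes> (b j \<ominus> b i') \<noteq> a' \<otimes> (b j \<ominus> b i)"
    if ij: "i < r" "i' < r" "j < r" "a \<in> A" "a' \<in> A" "i \<noteq> i'" "i \<noteq> j" "i' \<noteq> j" for i i' j a a'
  \<comment> \<open>The greedy choice separates distinct multipliers only. For equal ones the claim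
    comes from the injectivity of \<open>b\<close>.\<close>
  proof (cases "a = a'")
    case True
    have "b i = b i'" if "b j \<ominus> b i' = b j \<ominus> b i"
      using that b(1)[of i] b(1)[of i'] b(1)[of j] ij(1-3) by (simp add: minus_eq) (metis minus_minus)
    then have "b j \<ominus> b i' \<noteq> b j \<ominus> b i"
      using ij b(2) by (auto simp: inj_on_eq_iff)
    moreover have "a \<in> carrier R" "a \<noteq> \<zero>"
      using A(1) ij(4) by auto
    ultimately show ?thesis
      using b_diff(1)[of i j] b_diff(1)[of i' j] ij True by (simp add: m_lcancel)
  next
    case False
    then show ?thesis
      using A(3)[OF ij(4,5)] ij unfolding bad_def by blast
  qed
  then show ?thesis
    using A(1,2) by blast
qed

section \<open>The construction\<close>

locale quadratic_hypergraph = field F for F (structure) +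
  fixes r :: nat and b :: "nat \<Rightarrow> 'a" and A :: "'a set"
  assumes finite_carrier: "finite (carrier F)"
    and two_neq_zero: "\<one> \<oplus> \<one> \<noteq> \<zero>"
    and b_closed: "\<And>i. i < r \<Longrightarrow> b i \<in> carrier F"
    and b_inj: "inj_on b {..<r}"
    and A_subset: "A \<subseteq> carrier F - {\<zero>}"
    and cross: "\<And>i i' j a a'. \<lbrakk>i < r; i' < r; j < r; i \<noteq> i'; i \<noteq> j; i' \<noteq> j; a \<in> A; a' \<in> A\<rbrakk>
      \<Longrightarrow> a \<otimes> (b j \<ominus> b i') \<noteq> a' \<otimes> (b j \<ominus> b i)"
begin

definition edge :: "'a \<times> 'a \<times> 'a \<times> 'a \<Rightarrow> (nat \<times> 'a \<times> 'a) set" where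
  "edge = (\<lambda>(x, y, s, a). (\<lambda>i. (i, x \<oplus> b i \<otimes> s, y \<oplus> b i \<otimes> (a \<otimes> (s \<otimes> s)))) ` {..<r})"

text \<open>For \<open>s = \<zero>\<close> all multipliers \<open>a\<close> would yield the same
  edge, so this value is left out.\<close>

definition params :: "('a \<times> 'a \<times> 'a \<times> 'a) set" where
  "params = carrier F \<times> carrier F \<times> (carrier F - {\<zero>}) \<times> A"

definition edges :: "(nat \<times> 'a \<times> 'a) set set" where
  "edges = edge ` params"

text \<open>With \<open>u = (b j - b i) s\<close>, the second coordinate difference
  \<open>(b j - b i) a s^2\<close> along an edge becomes \<open>slope i j a\<close> times
  \<open>u^2\<close>.\<close>

definition slope :: "nat \<Rightarrow> nat \<Rightarrow> 'a \<Rightarrow> 'a" where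
  "slope i j a = a \<otimes> inv (b j \<ominus> b i)"

lemma A_closed: "a \<in> A \<Longrightarrow> a \<in> carrier F" "a \<in> A \<Longrightarrow> a \<noteq> \<zero>"
  using A_subset by auto

lemma finite_A: "finite A"
  using A_subset finite_carrier by (meson finite_Diff finite_subset)

lemma b_diff:
  assumes "i < r" "j < r" "i \<noteq> j"
  shows "b j \<ominus> b i \<in> carrier F" "b j \<ominus> b i \<noteq> \<zero>"
  using assms b_closed b_inj by (auto simp: inj_on_eq_iff)

lemma inv_b_diff:
  assumes "i < r" "j < r" "i \<noteq> j"
  shows "inv (b j \<ominus> b i) \<in> carrier F" "inv (b j \<ominus> b i) \<otimes> (b j \<ominus> b i) = \<one>"
  using b_diff[OF assms] by (auto simp: field_Units)

lemma slope_closed: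
  assumes "i < r" "j < r" "i \<noteq> j" "a \<in> A"
  shows "slope i j a \<in> carrier F"
  using inv_b_diff[OF assms(1-3)] A_closed assms(4) by (simp add: slope_def)

lemma slope_mult:
  assumes "i < r" "j < r" "i \<noteq> j" "a \<in> A"
  shows "slope i j a \<otimes> (b j \<ominus> b i) = a"
  using inv_b_diff[OF assms(1-3)] b_diff[OF assms(1-3)] A_closed assms(4)
  by (simp add: slope_def m_assoc)

lemma slope_neq_zero:
  assumes "i < r" "j < r" "i \<noteq> j" "a \<in> A"
  shows "slope i j a \<noteq> \<zero>"
  using slope_mult[OF assms] b_diff[OF assms(1-3)] A_closed(2)[OF assms(4)] by auto

lemma slope_eq_imp_eq:
  assumes "i < r" "j < r" "i \<noteq> j" "a \<in> A" "a' \<in> A" "slope i j a = slope i j a'"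
  shows "a = a'"
  using slope_mult[OF assms(1-4)] slope_mult[OF assms(1-3,5)] assms(6) by metis

lemma slope_neq:
  assumes "i < r" "i' < r" "j < r" "i \<noteq> i'" "i \<noteq> j" "i' \<noteq> j" "a \<in> A" "a' \<in> A"
  shows "slope i j a \<noteq> slope i' j a'"
proof
  assume eq: "slope i j a = slope i' j a'"
  note c = b_diff(1)[OF assms(1,3,5)] b_diff(1)[OF assms(2,3,6)] slope_closed[OF assms(1,3,5,7)]
  have "a \<otimes> (b j \<ominus> b i') = (slope i j a \<otimes> (b j \<ominus> b i)) \<otimes> (b j \<ominus> b i')"
    by (simp only: slope_mult[OF assms(1,3,5,7)])
  also have "\<dots> = (slope i j a \<otimes> (b j \<ominus> b i')) \<otimes> (b j \<ominus> b i)"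
    using c by (simp only: m_ac m_closed)
  also have "\<dots> = a' \<otimes> (b j \<ominus> b i)"
    by (simp only: eq slope_mult[OF assms(2,3,6,8)])
  finally show False
    using cross[OF assms] by simp
qed

section \<open>Linearity and the number of edges\<close>

lemma edge_diff:
  assumes "(x, y, s, a) \<in> params" "(i, P1, P2) \<in> edge (x, y, s, a)" "(j, R1, R2) \<in> edge (x, y, s, a)"
  shows "i < r" "j < r" "P1 \<in> carrier F" "P2 \<in> carrier F" "R1 \<in> carrier F" "R2 \<in> carrier F"
    and "R1 \<ominus> P1 = (b j \<ominus> b i) \<otimes> s" "R2 \<ominus> P2 = (b j \<ominus> b i) \<otimes> (a \<otimes> (s \<otimes> s))"
proof -
  have c: "x \<in> carrier F" "y \<in> carrier F" "s \<in> carrier F" "a \<in> carrier F"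
    using assms(1) A_closed by (auto simp: params_def)
  have P: "i < r" "P1 = x \<oplus> b i \<otimes> s" "P2 = y \<oplus> b i \<otimes> (a \<otimes> (s \<otimes> s))"
    and R: "j < r" "R1 = x \<oplus> b j \<otimes> s" "R2 = y \<oplus> b j \<otimes> (a \<otimes> (s \<otimes> s))"
    using assms(2,3) by (auto simp: edge_def)
  show "i < r" "j < r" "P1 \<in> carrier F" "P2 \<in> carrier F" "R1 \<in> carrier F" "R2 \<in> carrier F"
    using c P R b_closed by auto
  have diff: "(z \<oplus> v \<otimes> w) \<ominus> (z \<oplus> u \<otimes> w) = (v \<ominus> u) \<otimes> w"
    if "z \<in> carrier F" "u \<in> carrier F" "v \<in> carrier F" "w \<in> carrier F" for z u v w
    using that by algebra
  show "R1 \<ominus> P1 = (b j \<ominus> b i) \<otimes> s" "R2 \<ominus> P2 = (b j \<ominus> b i) \<otimes> (a \<otimes> (s \<otimes> s))"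
    unfolding P(2,3) R(2,3) using c P(1) R(1) b_closed by (auto intro!: diff)
qed

lemma same_part_imp_eq:
  assumes "p \<in> params" "(i, P1, P2) \<in> edge p" "(i, R1, R2) \<in> edge p"
  shows "(P1, P2) = (R1, R2)"
  using assms by (auto simp: edge_def split: prod.splits)

text \<open>The two points lie in different copies, so cancelling \<open>b j \<ominus> b i\<close>
  recovers \<open>s\<close>, then \<open>a\<close> because \<open>s \<noteq> \<zero>\<close>, and
  finally \<open>x\<close> and \<open>y\<close>. Concluding equality of parameters rather than of
  edges gives both linearity and the injectivity of \<open>edge\<close>.\<close>

lemma params_eq:
  assumes p: "p \<in> params" "p' \<in> params" and "P \<noteq> R" "{P, R} \<subseteq> edge p" "{P, R} \<subseteq> edge p'"
  shows "p = p'"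
proof -
  obtain x y s a where p_eq: "p = (x, y, s, a)" by (cases p)
  obtain x' y' s' a' where p'_eq: "p' = (x', y', s', a')" by (cases p')
  obtain i P1 P2 where P: "P = (i, P1, P2)" by (cases P)
  obtain j R1 R2 where R: "R = (j, R1, R2)" by (cases R)
  have ij: "i \<noteq> j"
    using same_part_imp_eq[OF p(1)] assms P R by fastforce
  have c: "x \<in> carrier F" "y \<in> carrier F" "s \<in> carrier F" "s \<noteq> \<zero>" "a \<in> carrier F"
    "x' \<in> carrier F" "y' \<in> carrier F" "s' \<in> carrier F" "a' \<in> carrier F"
    using p A_closed by (auto simp: params_def p_eq p'_eq)
  have d: "i < r" "j < r" "R1 \<ominus> P1 = (b j \<ominus> b i) \<otimes> s" "R2 \<ominus> P2 = (b j \<ominus> b i) \<otimes> (a \<otimes> (s \<otimes> s))"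
    using edge_diff[of x y s a i P1 P2 j R1 R2] assms P R by (simp_all add: p_eq)
  have d': "R1 \<ominus> P1 = (b j \<ominus> b i) \<otimes> s'" "R2 \<ominus> P2 = (b j \<ominus> b i) \<otimes> (a' \<otimes> (s' \<otimes> s'))"
    using edge_diff[of x' y' s' a' i P1 P2 j R1 R2] assms P R by (simp_all add: p'_eq)
  note bij = b_diff[OF d(1,2) ij]
  have "(b j \<ominus> b i) \<otimes> s = (b j \<ominus> b i) \<otimes> s'"
    using d(3) d'(1) by metis
  then have s: "s = s'"
    using bij c by (simp add: m_lcancel)
  have "(b j \<ominus> b i) \<otimes> (a \<otimes> (s \<otimes> s)) = (b j \<ominus> b i) \<otimes> (a' \<otimes> (s \<otimes> s))"
    using d(4) d'(2) unfolding s by metis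
  then have a: "a = a'"
    using bij c by (simp add: m_lcancel m_rcancel integral_iff)
  have "x \<oplus> b i \<otimes> s = x' \<oplus> b i \<otimes> s" "y \<oplus> b i \<otimes> (a \<otimes> (s \<otimes> s)) = y' \<oplus> b i \<otimes> (a \<otimes> (s \<otimes> s))"
    using assms(4,5) by (auto simp: edge_def p_eq p'_eq P s a)
  then have "x = x'" "y = y'"
    using c b_closed[OF d(1)] by simp_all
  then show ?thesis by (simp add: p_eq p'_eq s a)
qed

lemma card_edge: "card (edge p) = r"
  unfolding edge_def by (cases p) (auto simp: card_image inj_on_def)

lemma edge_subset: "p \<in> params \<Longrightarrow> edge p \<subseteq> {..<r} \<times> carrier F \<times> carrier F"
  using A_closed b_closed by (auto simp: edge_def params_def)

lemma card_edges:
  assumes "r \<ge> 2"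
  shows "card edges = card (carrier F) * (card (carrier F) * ((card (carrier F) - 1) * card A))"
proof -
  have "inj_on edge params"
  proof
    fix p p' assume p: "p \<in> params" "p' \<in> params" "edge p = edge p'"
    obtain P R where "P \<in> edge p" "R \<in> edge p" "P \<noteq> R"
      using assms card_edge[of p] by (metis card_2_iff' card_le_Suc0_iff_eq card.infinite not_less_eq_eq numeral_2_eq_2 not_numeral_le_zero)
    then show "p = p'"
      using p by (intro params_eq[of p p' P R]) auto
  qed
  then have "card edges = card params"
    by (simp add: edges_def card_image)
  then show ?thesis
    by (simp add: params_def card_cartesian_product card_Diff_singleton)
qed

section \<open>Common neighbours and codegrees\<close>

lemma adjacent:
  assumes "e \<in> edges" "{(i, P1, P2), (j, R1, R2)} \<subseteq> e" "(i, P1, P2) \<noteq> (j, R1, R2)"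
  shows "i < r" "j < r" "i \<noteq> j" "P1 \<in> carrier F" "P2 \<in> carrier F" "R1 \<in> carrier F" "R2 \<in> carrier F"
    and "\<exists>a\<in>A. R2 \<ominus> P2 = slope i j a \<otimes> ((R1 \<ominus> P1) \<otimes> (R1 \<ominus> P1))"
proof -
  obtain x y s a where e: "e = edge (x, y, s, a)" and p: "(x, y, s, a) \<in> params"
    using assms(1) by (auto simp: edges_def)
  note d = edge_diff[OF p, of i P1 P2 j R1 R2]
  show ij: "i < r" "j < r" "P1 \<in> carrier F" "P2 \<in> carrier F" "R1 \<in> carrier F" "R2 \<in> carrier F"
    using d assms(2) by (simp_all add: e)
  show "i \<noteq> j"
    using same_part_imp_eq[OF p] assms(2,3) e by fastforce
  note bij = b_diff[OF ij(1,2) this]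
  have a: "a \<in> A" "s \<in> carrier F" using p by (auto simp: params_def)
  note c = slope_closed[OF ij(1,2) \<open>i \<noteq> j\<close> a(1)] A_closed(1)[OF a(1)]
  \<comment> \<open>The parameter \<open>s\<close> is eliminated: one factor
    \<open>b j \<ominus> b i\<close> of the square cancels the denominator of the slope, the other
    remains.\<close>
  have "slope i j a \<otimes> ((R1 \<ominus> P1) \<otimes> (R1 \<ominus> P1)) = slope i j a \<otimes> (((b j \<ominus> b i) \<otimes> s) \<otimes> ((b j \<ominus> b i) \<otimes> s))"
    using d(7) assms(2) by (simp add: e)
  also have "\<dots> = (b j \<ominus> b i) \<otimes> ((slope i j a \<otimes> (b j \<ominus> b i)) \<otimes> (s \<otimes> s))"
    using bij(1) a(2) c by (simp only: m_ac m_closed)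
  also have "\<dots> = R2 \<ominus> P2"
    using d(8) assms(2) by (simp add: e slope_mult[OF ij(1,2) \<open>i \<noteq> j\<close> a(1)])
  finally show "\<exists>a\<in>A. R2 \<ominus> P2 = slope i j a \<otimes> ((R1 \<ominus> P1) \<otimes> (R1 \<ominus> P1))"
    using a(1) by metis
qed

text \<open>Coordinates are taken relative to the first vertex: \<open>(d, e)\<close> is the
  displacement to the second vertex and \<open>u\<close> the horizontal displacement to a common
  neighbour in copy \<open>j\<close>.\<close>

definition parabolas_meet :: "nat \<Rightarrow> nat \<Rightarrow> nat \<Rightarrow> 'a \<Rightarrow> 'a \<Rightarrow> 'a \<Rightarrow> 'a \<Rightarrow> 'a set" where
  "parabolas_meet i i' j d e a a' =
    {u \<in> carrier F. slope i j a \<otimes> (u \<otimes> u) = e \<oplus> slope i' j a' \<otimes> ((u \<ominus> d) \<otimes> (u \<ominus> d))}"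

lemma common_neighbour:
  assumes "e \<in> edges" "{(i, P1, P2), (j, R1, R2)} \<subseteq> e" "(i, P1, P2) \<noteq> (j, R1, R2)"
    and "e' \<in> edges" "{(i', Q1, Q2), (j, R1, R2)} \<subseteq> e'" "(i', Q1, Q2) \<noteq> (j, R1, R2)"
  shows "\<exists>a\<in>A. \<exists>a'\<in>A. \<exists>u\<in>parabolas_meet i i' j (Q1 \<ominus> P1) (Q2 \<ominus> P2) a a'.
    (R1, R2) = (P1 \<oplus> u, P2 \<oplus> slope i j a \<otimes> (u \<otimes> u))"
proof -
  note P = adjacent[OF assms(1-3)] and Q = adjacent[OF assms(4-6)]
  obtain a where a: "a \<in> A" "R2 \<ominus> P2 = slope i j a \<otimes> ((R1 \<ominus> P1) \<otimes> (R1 \<ominus> P1))"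
    using P(8) by blast
  obtain a' where a': "a' \<in> A" "R2 \<ominus> Q2 = slope i' j a' \<otimes> ((R1 \<ominus> Q1) \<otimes> (R1 \<ominus> Q1))"
    using Q(8) by blast
  have add_diff: "y \<oplus> (z \<ominus> y) = z" if "y \<in> carrier F" "z \<in> carrier F" for y z
    using that by algebra
  have "(R1 \<ominus> P1) \<ominus> (Q1 \<ominus> P1) = R1 \<ominus> Q1" "R2 \<ominus> P2 = (Q2 \<ominus> P2) \<oplus> (R2 \<ominus> Q2)"
    using P(4-7) Q(4-7) by algebra+
  then have "slope i j a \<otimes> ((R1 \<ominus> P1) \<otimes> (R1 \<ominus> P1)) = (Q2 \<ominus> P2) \<oplus>
      slope i' j a' \<otimes> (((R1 \<ominus> P1) \<ominus> (Q1 \<ominus> P1)) \<otimes> ((R1 \<ominus> P1) \<ominus> (Q1 \<ominus> P1)))"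
    using a(2) a'(2) by metis
  then have "R1 \<ominus> P1 \<in> parabolas_meet i i' j (Q1 \<ominus> P1) (Q2 \<ominus> P2) a a'"
    unfolding parabolas_meet_def using P(4,6) by (intro CollectI conjI minus_closed)
  moreover have "R1 = P1 \<oplus> (R1 \<ominus> P1)" "R2 = P2 \<oplus> slope i j a \<otimes> ((R1 \<ominus> P1) \<otimes> (R1 \<ominus> P1))"
    using P(4-7) by (simp_all only: add_diff flip: a(2))
  ultimately show ?thesis
    using a(1) a'(1) by blast
qed

text \<open>The two slopes differ, by the separation of the multipliers if
  \<open>i \<noteq> i'\<close> and by the injectivity of \<open>slope i j\<close> on
  \<open>A\<close> otherwise.\<close>

lemma card_parabolas_meet_le_2:
  assumes "i < r" "i' < r" "j < r" "i \<noteq> j" "i' \<noteq> j" "d \<in> carrier F" "e \<in> carrier F"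
    and "a \<in> A" "a' \<in> A" "i \<noteq> i' \<or> a \<noteq> a'"
  shows "card (parabolas_meet i i' j d e a a') \<le> 2"
  unfolding parabolas_meet_def using assms slope_neq[of i i' j a a'] slope_eq_imp_eq[of i j a a']
  by (intro card_quadratic_solutions_le_2) (auto intro: slope_closed)

lemma card_parabolas_meet_le_1:
  assumes "i < r" "j < r" "i \<noteq> j" "d \<in> carrier F" "e \<in> carrier F" "a \<in> A" "d \<noteq> \<zero> \<or> e \<noteq> \<zero>"
  shows "card (parabolas_meet i i j d e a a) \<le> 1"
  unfolding parabolas_meet_def using assms slope_closed[of i j a] slope_neq_zero[of i j a] two_neq_zero
  by (intro card_quadratic_solutions_le_1) auto

text \<open>A common neighbour is determined by its copy \<open>j\<close>, the two multipliers and
  \<open>u\<close>. The copies \<open>i\<close> and \<open>i'\<close> contribute nothing, as an edge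
  meets each copy only once.\<close>

lemma card_common_neighbours_le_sum:
  assumes "P1 \<in> carrier F" "P2 \<in> carrier F" "Q1 \<in> carrier F" "Q2 \<in> carrier F"
    and S: "(i, P1, P2) \<notin> S" "(i', Q1, Q2) \<notin> S"
      "\<And>z. z \<in> S \<Longrightarrow> (\<exists>e\<in>edges. {(i, P1, P2), z} \<subseteq> e) \<and> (\<exists>e\<in>edges. {(i', Q1, Q2), z} \<subseteq> e)"
  shows "card S \<le> (\<Sum>(j, a, a')\<in>({..<r} - {i, i'}) \<times> A \<times> A. card (parabolas_meet i i' j (Q1 \<ominus> P1) (Q2 \<ominus> P2) a a'))"
proof -
  define I where "I = ({..<r} - {i, i'}) \<times> A \<times> A"
  define N where "N = (\<lambda>(j, a, a'). (\<lambda>u. (j, P1 \<oplus> u, P2 \<oplus> slope i j a \<otimes> (u \<otimes> u))) `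
    parabolas_meet i i' j (Q1 \<ominus> P1) (Q2 \<ominus> P2) a a')"
  have fin: "finite (parabolas_meet i i' j d e a a')" for j d e a a'
    unfolding parabolas_meet_def using finite_carrier by simp
  have finI: "finite I" by (simp add: I_def finite_A)
  have "S \<subseteq> (\<Union>k\<in>I. N k)"
  proof
    fix z assume z: "z \<in> S"
    obtain j R1 R2 where z_eq: "z = (j, R1, R2)" by (cases z)
    obtain e e' where e: "e \<in> edges" "{(i, P1, P2), (j, R1, R2)} \<subseteq> e"
      and e': "e' \<in> edges" "{(i', Q1, Q2), (j, R1, R2)} \<subseteq> e'"
      using S(3)[OF z] unfolding z_eq by blast
    have neq: "(i, P1, P2) \<noteq> (j, R1, R2)" "(i', Q1, Q2) \<noteq> (j, R1, R2)"
      using S(1,2) z z_eq by blast+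
    obtain a a' u where "a \<in> A" "a' \<in> A" "u \<in> parabolas_meet i i' j (Q1 \<ominus> P1) (Q2 \<ominus> P2) a a'"
      "z = (j, P1 \<oplus> u, P2 \<oplus> slope i j a \<otimes> (u \<otimes> u))"
      using common_neighbour[OF e neq(1) e' neq(2)] unfolding z_eq by blast
    moreover have "j \<in> {..<r} - {i, i'}"
      using adjacent(2,3)[OF e neq(1)] adjacent(3)[OF e' neq(2)] by simp
    ultimately show "z \<in> (\<Union>k\<in>I. N k)"
      unfolding I_def N_def by (intro UN_I[of "(j, a, a')"]) auto
  qed
  then have "card S \<le> card (\<Union>k\<in>I. N k)"
    using finI fin by (intro card_mono) (auto simp: N_def)
  also have "\<dots> \<le> (\<Sum>k\<in>I. card (N k))"
    by (rule card_UN_le[OF finI])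
  also have "\<dots> \<le> (\<Sum>(j, a, a')\<in>I. card (parabolas_meet i i' j (Q1 \<ominus> P1) (Q2 \<ominus> P2) a a'))"
    by (intro sum_mono) (auto simp: N_def split: prod.splits intro!: card_image_le fin)
  finally show ?thesis by (simp only: I_def)
qed

lemma Union_edges_subset: "\<Union>edges \<subseteq> {..<r} \<times> carrier F \<times> carrier F"
  unfolding edges_def by (intro Union_least) (blast dest: edge_subset)

lemma codegree_le:
  assumes r: "2 \<le> r" "r \<le> 2 * card A + 1" and "P \<noteq> Q" "P \<notin> S" "Q \<notin> S"
    and S: "\<And>z. z \<in> S \<Longrightarrow> (\<exists>e\<in>edges. {P, z} \<subseteq> e) \<and> (\<exists>e\<in>edges. {Q, z} \<subseteq> e)"
  shows "card S \<le> (r - 1) * (card A * (2 * card A - 1))"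
proof (cases "S = {}")
  case False
  then obtain z where z: "z \<in> S" by blast
  obtain i P1 P2 where P: "P = (i, P1, P2)" by (cases P)
  obtain i' Q1 Q2 where Q: "Q = (i', Q1, Q2)" by (cases Q)
  \<comment> \<open>A common neighbour guarantees that \<open>P\<close> and \<open>Q\<close> lie on
    edges, hence are vertices of the construction.\<close>
  have "P \<in> \<Union>edges" "Q \<in> \<Union>edges"
    using S[OF z] by auto
  then have c: "i < r" "P1 \<in> carrier F" "P2 \<in> carrier F" "i' < r" "Q1 \<in> carrier F" "Q2 \<in> carrier F"
    using Union_edges_subset by (auto simp: P Q)
  define l where "l = card A"
  define d where "d = Q1 \<ominus> P1"
  define e where "e = Q2 \<ominus> P2"
  have de: "d \<in> carrier F" "e \<in> carrier F"
    using c by (simp_all add: d_def e_def)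
  have le: "card S \<le> (\<Sum>(j, a, a')\<in>({..<r} - {i, i'}) \<times> A \<times> A. card (parabolas_meet i i' j d e a a'))"
    unfolding d_def e_def using assms(4,5) S c by (intro card_common_neighbours_le_sum) (auto simp: P Q)
  show ?thesis
  proof (cases "i = i'")
    case True
    then have neq: "d \<noteq> \<zero> \<or> e \<noteq> \<zero>"
      using \<open>P \<noteq> Q\<close> c by (auto simp: P Q d_def e_def)
    have "card (parabolas_meet i i' j d e a a') \<le> (if a' = a then 1 else 2)"
      if "j \<in> {..<r} - {i, i'}" "a \<in> A" "a' \<in> A" for j a a'
      using that c de neq card_parabolas_meet_le_1[of i j d e a] card_parabolas_meet_le_2[of i i j d e a a']
      by (cases "a' = a") (auto simp flip: True)
    then have "(\<Sum>(j, a, a')\<in>({..<r} - {i, i'}) \<times> A \<times> A. card (parabolas_meet i i' j d e a a'))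
        \<le> (\<Sum>(j, a, a')\<in>({..<r} - {i, i'}) \<times> A \<times> A. if a' = a then 1 else 2)"
      by (intro sum_mono) (simp only: mem_Times_iff split_beta)
    also have "\<dots> = (\<Sum>j\<in>{..<r} - {i, i'}. \<Sum>a\<in>A. \<Sum>a'\<in>A. if a' = a then 1 else 2)"
      by (simp only: sum.cartesian_product)
    \<comment> \<open>For each \<open>a\<close>, the choice \<open>a' = a\<close> counts 1 and the
      other \<open>l - 1\<close> choices count 2 each.\<close>
    also have "\<dots> = (\<Sum>j\<in>{..<r} - {i, i'}. \<Sum>a\<in>A. 2 * l - 1)"
    proof (intro sum.cong refl)
      fix a assume "a \<in> A"
      then have "(\<Sum>a'\<in>A. if a' = a then 1 else 2) = 1 + (\<Sum>a'\<in>A - {a}. 2 :: nat)"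
        using finite_A by (subst sum.remove[of A a]) (auto intro!: sum.cong)
      also have "\<dots> = 2 * l - 1"
        using \<open>a \<in> A\<close> finite_A card_gt_0_iff[of A] by (auto simp: l_def card_Diff_singleton)
      finally show "(\<Sum>a'\<in>A. if a' = a then 1 else 2) = 2 * l - 1" .
    qed
    also have "\<dots> = (r - 1) * (l * (2 * l - 1))"
      using True c(1) by (simp add: l_def card_Diff_singleton)
    finally show ?thesis
      using le by (simp add: l_def)
  next
    case False
    have "card (parabolas_meet i i' j d e a a') \<le> 2"
      if "j \<in> {..<r} - {i, i'}" "a \<in> A" "a' \<in> A" for j a a'
      using that c de False by (intro card_parabolas_meet_le_2) auto
    then have "(\<Sum>(j, a, a')\<in>({..<r} - {i, i'}) \<times> A \<times> A. card (parabolas_meet i i' j d e a a'))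
        \<le> (\<Sum>k\<in>({..<r} - {i, i'}) \<times> A \<times> A. 2)"
      by (intro sum_mono) (simp only: mem_Times_iff split_beta)
    also have "\<dots> = (r - 2) * (l * l) * 2"
      using False c by (simp add: l_def card_cartesian_product card_Diff_subset numeral_2_eq_2)
    also have "\<dots> = l * ((r - 2) * (2 * l))"
      by (simp add: algebra_simps)
    \<comment> \<open>Over the integers,
      \<open>(r - 1) (2 l - 1) - (r - 2) 2 l = 2 l + 1 - r\<close>, so this is where
      \<open>r \<le> 2 l + 1\<close> enters. The substitution by \<open>k\<close> and
      \<open>m\<close> avoids truncated subtraction.\<close>
    also have "\<dots> \<le> l * ((r - 1) * (2 * l - 1))"
    proof -
      define k m where "k = r - 2" and "m = l - 1"
      then have "r = k + 2" "l = m + 1"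
        using r by (simp_all add: l_def)
      moreover have "k \<le> 2 * m + 1"
        using r by (simp add: k_def m_def l_def)
      ultimately have "(r - 2) * (2 * l) \<le> (r - 1) * (2 * l - 1)"
        by (simp add: algebra_simps)
      then show ?thesis by (rule mult_le_mono2)
    qed
    finally show ?thesis
      using le by (simp add: l_def algebra_simps)
  qed
qed simp

section \<open>Freeness and relabelling of the vertices\<close>

lemma family_free_edges:
  assumes r: "2 \<le> r" "r \<le> 2 * card A + 1" and t: "t = (r - 1) * (card A * (2 * card A - 1))"
  shows "\<not> contains_Berge edges C2" "\<not> contains_Berge edges (K2 (t + 1))"
proof -
  show "\<not> contains_Berge edges C2"
  proof
    assume "contains_Berge edges C2"
    then obtain e e' P Q where "e \<in> edges" "e' \<in> edges" "e \<noteq> e'" "P \<noteq> Q" "{P, Q} \<subseteq> e \<inter> e'"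
      using contains_Berge_C2 by blast
    then obtain p p' where "p \<in> params" "p' \<in> params" "edge p \<noteq> edge p'" "{P, Q} \<subseteq> edge p" "{P, Q} \<subseteq> edge p'"
      unfolding edges_def by blast
    with params_eq \<open>P \<noteq> Q\<close> show False by metis
  qed
  show "\<not> contains_Berge edges (K2 (t + 1))"
  proof
    assume "contains_Berge edges (K2 (t + 1))"
    then obtain P Q S where "P \<noteq> Q" "card S = t + 1" "P \<notin> S" "Q \<notin> S"
      "\<And>z. z \<in> S \<Longrightarrow> (\<exists>e\<in>edges. {P, z} \<subseteq> e) \<and> (\<exists>e\<in>edges. {Q, z} \<subseteq> e)"
      by (rule contains_Berge_K2) (rule that)
    then have "card S \<le> t"
      unfolding t by (intro codegree_le[OF r, of P Q]) simp_all
    then show False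
      using \<open>card S = t + 1\<close> by simp
  qed
qed

text \<open>The construction lives on triples while \<open>ex_r\<close> counts hypergraphs on
  \<open>{0..<n}\<close>. A bijection \<open>h\<close> transports it, and Berge copies in the image
  are pulled back.\<close>

lemma card_edges_le_ex_r:
  assumes r: "2 \<le> r" "r \<le> 2 * card A + 1" and t: "t = (r - 1) * (card A * (2 * card A - 1))"
    and n: "n = r * card (carrier F) ^ 2"
  shows "card edges \<le> ex_r r n {C2, K2 (t + 1)}"
proof -
  define V where "V = {..<r} \<times> carrier F \<times> carrier F"
  have edges: "\<Union>edges \<subseteq> V"
    using Union_edges_subset by (simp only: V_def)
  have "finite V" "card V = n"
    using finite_carrier by (simp_all add: V_def n card_cartesian_product power2_eq_square)
  then obtain h where h: "bij_betw h V {0..<n}"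
    using ex_bij_betw_finite_nat by blast
  then have inj: "inj_on h (\<Union>edges)"
    using edges by (auto simp: bij_betw_def intro: inj_on_subset)
  define H where "H = (`) h ` edges"
  have "card H = card edges"
    unfolding H_def by (intro card_image inj_on_image inj)
  moreover have "uniform_hypergraph r n H"
    unfolding uniform_hypergraph_def
  proof
    fix g assume "g \<in> H"
    then obtain e where e: "e \<in> edges" "g = h ` e" by (auto simp: H_def)
    have "inj_on h e"
      using e(1) by (intro inj_on_subset[OF inj]) blast
    moreover have "card e = r"
      using e(1) card_edge by (auto simp: edges_def)
    ultimately have "card g = r"
      by (simp add: e(2) card_image)
    moreover have "h ` e \<subseteq> {0..<n}"
      using e(1) edges h by (auto simp: bij_betw_def)
    ultimately show "g \<subseteq> {0..<n} \<and> card g = r"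
      by (simp add: e(2))
  qed
  \<comment> \<open>No vertex is isolated, as the pull-back requires: \<open>v < 2\<close> is an end
    of the edge \<open>v\<close>, any other \<open>v\<close> of the edge
    \<open>2 * (v - 2)\<close>.\<close>
  moreover have "mverts (K2 (t + 1)) = \<Union> (mends (K2 (t + 1)) ` medges (K2 (t + 1)))"
  proof -
    have "v \<in> (\<Union>e\<in>{0..<2 * (t + 1)}. {e mod 2, e div 2 + 2})" if "v < t + 3" for v
    proof (cases "v < 2")
      case True
      then show ?thesis by (intro UN_I[of v]) auto
    next
      case False
      then show ?thesis using that by (intro UN_I[of "2 * (v - 2)"]) auto
    qed
    then show ?thesis by (auto simp: K2_def)
  qed
  then have "family_free H {C2, K2 (t + 1)}"
    using family_free_edges[OF r t] contains_Berge_imageD[OF inj]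
    by (auto simp: family_free_def H_def C2_def)
  ultimately show ?thesis
    using card_le_ex_r[of r n H] by simp
qed

end

text \<open>For \<open>n = r q^2\<close> the right-hand side equals \<open>l q^3 - l q^2\<close>,
  which is exactly the number \<open>q^2 (q - 1) l\<close> of edges of the construction.\<close>

theorem theorem1p4:
  fixes r q n t :: nat and l :: int
  assumes "r \<ge> 3"
    and "2 * l + 1 \<ge> int r"
    and "\<exists>p k. prime p \<and> odd p \<and> k \<ge> 1 \<and> q = p ^ k"
    and "int q \<ge> 2 * l * int r ^ 3"
    and "n = r * q ^ 2"
    and "int t = (int r - 1) * (2 * l ^ 2 - l)"
  shows "real (ex_r r n {C2, K2 (t + 1)})
           \<ge> real_of_int l / real r powr (3/2) * real n powr (3/2) - real_of_int l / real r * real n"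
proof -
  obtain m where m: "l = int m" "m \<ge> 1"
    using assms(1,2) by (intro that[of "nat l"]) auto
  have r: "2 \<le> r" "r \<le> 2 * m + 1"
    using assms(1,2) by (simp_all add: m)
  have q: "2 * m * r ^ 3 \<le> q"
    using assms(4) unfolding m by (metis of_nat_le_iff of_nat_mult of_nat_numeral of_nat_power)
  have "1 < r ^ 3"
    using r by (intro one_less_power) auto
  then have "m * 1 < m * r ^ 3"
    using m by (intro mult_strict_left_mono) auto
  moreover have "m * (r ^ 3 + 1) = m * r ^ 3 + m * 1" "2 * m * r ^ 3 = m * r ^ 3 + m * r ^ 3"
    by (simp_all add: algebra_simps)
  \<comment> \<open>The factor 2 in the bound on \<open>q\<close> absorbs the extra
    \<open>m\<close>, since \<open>r ^ 3 > 1\<close>.\<close>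
  ultimately have large: "m * (r ^ 3 + 1) < q"
    using q by linarith
  have "1 * r \<le> m * r ^ 3"
    using m r self_le_power[of r 3] by (intro mult_mono) auto
  \<comment> \<open>Provides enough field elements for \<open>r\<close> distinct values of
    \<open>b\<close>.\<close>
  then have "r \<le> q"
    using large by (simp add: distrib_left)
  have t: "t = (r - 1) * (m * (2 * m - 1))"
  proof -
    have "int t = int ((r - 1) * (m * (2 * m - 1)))"
    proof -
      have "int (r - 1) = int r - 1" "int (2 * m - 1) = 2 * int m - 1"
        using m(2) r by auto
      moreover have "2 * l ^ 2 - l = l * (2 * l - 1)"
        by (simp add: algebra_simps power2_eq_square)
      ultimately show ?thesis
        by (simp only: assms(6) of_nat_mult flip: m(1))
    qed
    then show ?thesis by (simp only: of_nat_eq_iff)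
  qed
  obtain p k where pk: "prime p" "odd p" "k \<ge> 1" "q = p ^ k"
    using assms(3) by blast
  obtain F :: "((int list \<times> nat) multiset \<Rightarrow> int) ring" where F: "field F" "card (carrier F) = q"
    using exists_finite_field[of p k] pk by auto
  interpret F: field F by (rule F)
  have fin: "finite (carrier F)"
    using F(2) large by (metis card.infinite not_less_zero)
  obtain b where b: "bij_betw b {0..<q} (carrier F)"
    using ex_bij_betw_nat_finite[OF fin] F(2) by auto
  have b_closed: "b i \<in> carrier F" if "i < r" for i
    using b that \<open>r \<le> q\<close> by (auto simp: bij_betw_def)
  have b_inj: "inj_on b {..<r}"
    using b \<open>r \<le> q\<close> by (auto simp: bij_betw_def intro: inj_on_subset)
  obtain A where A: "A \<subseteq> carrier F - {\<zero>\<^bsub>F\<^esub>}" "card A = m"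
    "\<forall>i<r. \<forall>i'<r. \<forall>j<r. \<forall>a\<in>A. \<forall>a'\<in>A. i \<noteq> i' \<and> i \<noteq> j \<and> i' \<noteq> j
      \<longrightarrow> a \<otimes>\<^bsub>F\<^esub> (b j \<ominus>\<^bsub>F\<^esub> b i') \<noteq> a' \<otimes>\<^bsub>F\<^esub> (b j \<ominus>\<^bsub>F\<^esub> b i)"
    using F.exists_separated_multipliers[OF fin b_closed b_inj, of m] large F(2) by blast
  interpret quadratic_hypergraph F r b A
  proof
    show "\<one>\<^bsub>F\<^esub> \<oplus>\<^bsub>F\<^esub> \<one>\<^bsub>F\<^esub> \<noteq> \<zero>\<^bsub>F\<^esub>"
      using pk by (intro F.two_neq_zero_if_odd_order) (simp add: F(2))
  qed (use fin b_closed b_inj A in blast)+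
  have "q * (q * ((q - 1) * m)) \<le> ex_r r n {C2, K2 (t + 1)}"
    using card_edges_le_ex_r[of t n] card_edges r t assms(5) by (simp add: A(2) F(2))
  then have "real (q * (q * ((q - 1) * m))) \<le> real (ex_r r n {C2, K2 (t + 1)})"
    by (simp only: of_nat_le_iff)
  moreover have "real (q * (q * ((q - 1) * m))) = real m * real q ^ 3 - real m * real q ^ 2"
    using large by (simp add: of_nat_diff algebra_simps power2_eq_square power3_eq_cube)
  moreover have "real n powr (3/2) = real r powr (3/2) * real q ^ 3"
  proof -
    have "real q > 0" using large by simp
    then have "(real q ^ 2) powr (3/2) = real q ^ 3"
      by (simp add: powr_powr flip: powr_numeral)
    then show ?thesis
      by (simp add: assms(5) powr_mult)
  qed
  moreover have "real_of_int l / real r powr (3/2) * (real r powr (3/2) * real q ^ 3) = real m * real q ^ 3"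
    using r by (simp add: m)
  moreover have "real_of_int l / real r * real n = real m * real q ^ 2"
    using r by (simp add: m assms(5))
  ultimately show ?thesis
    by simp
qed

end
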